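(* Let $\alpha,\tau>0$ and let $h,k>0$ be the mesh size and time step. Let $\boldsymbol m_h^{n-1},\boldsymbol m_h^n,\boldsymbol m_h^{n+1}$ be grid functions with values in $\mathbb S^2$ which satisfy, at every grid point, the implicit scheme $$\frac{\boldsymbol m_h^{n+1}-\boldsymbol m_h^{n-1}}{2k}-\alpha\,\frac{\boldsymbol m_h^{n+1}+\boldsymbol m_h^{n-1}}2\times\Big(\frac{\boldsymbol m_h^{n+1}-\boldsymbol m_h^{n-1}}{2k}+\tau\,\frac{\boldsymbol m_h^{n+1}-2\boldsymbol m_h^n+\boldsymbol m_h^{n-1}}{k^2}\Big)=-\frac{\boldsymbol m_h^{n+1}+\boldsymbol m_h^{n-1}}2\times\Delta_h\Big(\frac{\boldsymbol m_h^{n+1}+\boldsymbol m_h^{n-1}}2\Big).$$ Define the modified energy $$E(\boldsymbol u,\boldsymbol v)=\frac{\alpha\tau}2\Big\|\frac{\boldsymbol u-\boldsymbol v}{k}\Big\|_2^2+\frac14\big(\|\nabla_h\boldsymbol u\|_2^2+\|\nabla_h\boldsymbol v\|_2^2\big).$$ Then $$E(\boldsymbol m_h^{n+1},\boldsymbol m_h^n)\le E(\boldsymbol m_h^n,\boldsymbol m_h^{n-1}).$$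
   Context: Grid: $\Omega=(0,1)^d$, $d\in\{1,2,3\}$, is divided into $N^d$ uniform cells, $h=1/N$; grid points are the cell centers, e.g. for $d=3$ $\boldsymbol x_{i,j,l}=((i-\tfrac12)h,(j-\tfrac12)h,(l-\tfrac12)h)$ with $1\le i,j,l\le N$. A grid function assigns a vector in $\mathbb R^3$ to each grid point and is extended to ghost points (an index equal to $0$ or $N+1$) by the homogeneous Neumann extrapolation: the value at index $0$ equals the value at index $1$, and the value at index $N+1$ equals the value at index $N$, in each direction. $\Delta_h$ is the standard $(2d+1)$-point (seven-point for $d=3$) discrete Laplacian using these ghost values. $\nabla_h$ is the compact central-difference gradient, with values $(\boldsymbol f_{i+1}-\boldsymbol f_i)/h$ located at the faces between neighbouring cells in each coordinate direction (it vanishes on boundary faces), so that $\langle-\Delta_h\boldsymbol f,\boldsymbol g\rangle=\langle\nabla_h\boldsymbol f,\nabla_h\boldsymbol g\rangle$. Discrete inner product and norm: $\langle\boldsymbol f,\boldsymbol g\rangle=h^d\sum_{\boldsymbol x_l}\boldsymbol f(\boldsymbol x_l)\cdot\boldsymbol g(\boldsymbol x_l)$ over all grid points, $\|\boldsymbol f\|_2^2=\langle\boldsymbol f,\boldsymbol f\rangle$; $\|\nabla_h\boldsymbol f\|_2^2$ is $h^d$ times the sum of the squares of all face differences. $\times$ is the cross product in $\mathbb R^3$, $\mathbb S^2$ the unit sphere in $\mathbb R^3$. *)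

theory Defs
  imports "HOL-Analysis.Cross3" "HOL-Analysis.Cartesian_Euclidean_Space"
begin

text \<open>
  The dimension is \<open>d = CARD('d)\<close>.  The cell with centre
  \<open>((i $ a - 1/2) * h)\<close>, \<open>a\<close> ranging over the coordinate directions, is represented by its
  multi-index \<open>i\<close>, and a grid function by a function on multi-indices of which only the values
  on \<open>grid_points N\<close> matter: every operator below reads its argument at other
  indices only through \<open>neumann_ext\<close>.
\<close>

type_synonym 'd grid_fun = "int ^ 'd \<Rightarrow> real ^ 3"

definition mesh_size :: "nat \<Rightarrow> real" where
  "mesh_size N = 1 / real N"

definition grid_points :: "nat \<Rightarrow> (int ^ 'd::finite) set" where
  "grid_points N = {i. \<forall>a. 1 \<le> i $ a \<and> i $ a \<le> int N}"

definition ghost_index :: "nat \<Rightarrow> int \<Rightarrow> int" where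
  "ghost_index N j = (if j = 0 then 1 else if j = int N + 1 then int N else j)"

definition neumann_ext :: "nat \<Rightarrow> ('d::finite) grid_fun \<Rightarrow> 'd grid_fun" where
  "neumann_ext N f i = f (\<chi> a. ghost_index N (i $ a))"

definition disc_laplace :: "nat \<Rightarrow> ('d::finite) grid_fun \<Rightarrow> 'd grid_fun" where
  "disc_laplace N f i =
     (\<Sum>a\<in>UNIV. (neumann_ext N f (i + axis a 1) - 2 *\<^sub>R neumann_ext N f i
                + neumann_ext N f (i - axis a 1)) /\<^sub>R (mesh_size N)\<^sup>2)"

text \<open>
  In direction \<open>a\<close>, the index \<open>i\<close> labels the face between the cells \<open>i\<close> and \<open>i + axis a 1\<close>;
  the boundary faces are those with \<open>i $ a = 0\<close> or \<open>i $ a = N\<close>.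
\<close>

definition grid_faces :: "nat \<Rightarrow> 'd::finite \<Rightarrow> (int ^ 'd) set" where
  "grid_faces N a =
     {i. 0 \<le> i $ a \<and> i $ a \<le> int N \<and> (\<forall>b. b \<noteq> a \<longrightarrow> 1 \<le> i $ b \<and> i $ b \<le> int N)}"

definition disc_grad :: "nat \<Rightarrow> ('d::finite) grid_fun \<Rightarrow> 'd \<Rightarrow> 'd grid_fun" where
  "disc_grad N f a i = (neumann_ext N f (i + axis a 1) - neumann_ext N f i) /\<^sub>R mesh_size N"

definition grid_inner :: "nat \<Rightarrow> ('d::finite) grid_fun \<Rightarrow> 'd grid_fun \<Rightarrow> real" where
  "grid_inner N f g = mesh_size N ^ CARD('d) * (\<Sum>i\<in>grid_points N. f i \<bullet> g i)"

definition grid_norm :: "nat \<Rightarrow> ('d::finite) grid_fun \<Rightarrow> real" where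
  "grid_norm N f = sqrt (grid_inner N f f)"

definition face_inner ::
    "nat \<Rightarrow> ('d::finite \<Rightarrow> 'd grid_fun) \<Rightarrow> ('d \<Rightarrow> 'd grid_fun) \<Rightarrow> real" where
  "face_inner N F G =
     mesh_size N ^ CARD('d) * (\<Sum>a\<in>UNIV. \<Sum>i\<in>grid_faces N a. F a i \<bullet> G a i)"

definition face_norm :: "nat \<Rightarrow> ('d::finite \<Rightarrow> 'd grid_fun) \<Rightarrow> real" where
  "face_norm N F = sqrt (face_inner N F F)"

definition modified_energy ::
    "nat \<Rightarrow> real \<Rightarrow> real \<Rightarrow> real \<Rightarrow> ('d::finite) grid_fun \<Rightarrow> 'd grid_fun \<Rightarrow> real" where
  "modified_energy N k \<alpha> \<tau> u v =
     \<alpha> * \<tau> / 2 * (grid_norm N (\<lambda>i. (u i - v i) /\<^sub>R k))\<^sup>2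
     + 1 / 4 * ((face_norm N (disc_grad N u))\<^sup>2 + (face_norm N (disc_grad N v))\<^sup>2)"

lemma finite_bounded_index: "finite {i :: int ^ 'd::finite. \<forall>a. l \<le> i $ a \<and> i $ a \<le> u}"
proof -
  have "{i :: int ^ 'd. \<forall>a. l \<le> i $ a \<and> i $ a \<le> u}
          \<subseteq> vec_lambda ` (PiE UNIV (\<lambda>_. {l..u}))"
  proof
    fix i :: "int ^ 'd" assume "i \<in> {i. \<forall>a. l \<le> i $ a \<and> i $ a \<le> u}"
    then have "i = vec_lambda (vec_nth i)" "vec_nth i \<in> PiE UNIV (\<lambda>_. {l..u})"
      by (auto simp: vec_nth_inverse)
    then show "i \<in> vec_lambda ` (PiE UNIV (\<lambda>_. {l..u}))" by blast
  qed
  then show ?thesis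
    by (rule finite_subset) (intro finite_imageI finite_PiE; simp)
qed

lemma finite_grid_points: "finite (grid_points N)"
  unfolding grid_points_def by (rule finite_bounded_index)

lemma finite_grid_faces: "finite (grid_faces N a)"
  by (rule finite_subset[OF _ finite_bounded_index[of 0 "int N"]])
    (force simp: grid_faces_def)

lemma disc_grad_boundary_face:
  assumes "N \<ge> 1" and "i $ a = 0 \<or> i $ a = int N"
  shows "disc_grad N f a i = 0"
proof -
  have "ghost_index N ((i + axis a 1) $ b) = ghost_index N (i $ b)" for b
    using assms by (auto simp: ghost_index_def axis_def)
  then show ?thesis by (simp add: disc_grad_def neumann_ext_def)
qed

end

theory Submission
  imports Defs
begin

text \<open>
  Write \<open>D\<close> for the centred difference quotient, \<open>M\<close> for the average and \<open>W\<close> for the second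
  difference quotient in time.  The scheme reads
  \<open>D = M \<times> (\<alpha> D + \<alpha> \<tau> W - \<Delta>\<^sub>h M)\<close>, so \<open>D\<close> is pointwise orthogonal to the
  bracket.  Summing the orthogonality relation over the grid and integrating by parts gives
  \<open>\<alpha> \<parallel>D\<parallel>\<^sup>2 + \<alpha> \<tau> \<langle>W, D\<rangle> + \<langle>\<nabla>\<^sub>h M, \<nabla>\<^sub>h D\<rangle> = 0\<close>.  The last
  two terms are differences of squares, and their sum is the energy increment divided by \<open>k\<close>.
\<close>

lemma neumann_ext_grid_points: "i \<in> grid_points N \<Longrightarrow> neumann_ext N f i = f i"
  unfolding neumann_ext_def by (rule arg_cong[where f = f])
    (simp add: vec_eq_iff grid_points_def ghost_index_def, smt (verit))

text \<open>Divergence form: in direction \<open>a\<close> the cell \<open>i\<close> lies between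
  the faces \<open>i\<close> and \<open>i - axis a 1\<close>, so the second difference is the
  difference of the two face gradients.\<close>

lemma disc_laplace_eq_disc_grad:
  "disc_laplace N f i =
    (\<Sum>a\<in>UNIV. (disc_grad N f a i - disc_grad N f a (i - axis a 1)) /\<^sub>R mesh_size N)"
  unfolding disc_laplace_def disc_grad_def
  by (intro sum.cong refl) (simp add: power2_eq_square algebra_simps scaleR_2)

lemma grid_points_subset_grid_faces: "grid_points N \<subseteq> grid_faces N a"
  unfolding grid_points_def grid_faces_def by (auto simp: order_trans[OF zero_le_one])

lemma grid_points_shift_subset_grid_faces: "(\<lambda>i. i - axis a 1) ` grid_points N \<subseteq> grid_faces N a"
  unfolding grid_points_def grid_faces_def by (auto simp: axis_def, (smt (verit))+)

text \<open>The faces in direction \<open>a\<close> form layers 0 to \<open>N\<close>. Cells, read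
  as their upper faces, miss only layer 0, where the Neumann ghost value makes the gradient
  vanish.\<close>

lemma disc_grad_eq_0_off_grid_points:
  assumes "N \<ge> 1" and "i \<in> grid_faces N a - grid_points N"
  shows "disc_grad N f a i = 0"
proof -
  have "i $ a = 0"
  proof (rule ccontr)
    assume "i $ a \<noteq> 0"
    then have "1 \<le> i $ b \<and> i $ b \<le> int N" for b
      using assms(2) by (cases "b = a") (auto simp: grid_faces_def)
    then show False
      using assms(2) by (auto simp: grid_points_def)
  qed
  then show ?thesis
    using assms(1) by (simp add: disc_grad_boundary_face)
qed

text \<open>Mirror case: cells, read as their lower faces, miss only the boundary layer
  \<open>N\<close>.\<close>

lemma disc_grad_eq_0_off_shifted_grid_points:
  assumes "N \<ge> 1" and "i \<in> grid_faces N a - (\<lambda>i. i - axis a 1) ` grid_points N"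
  shows "disc_grad N f a i = 0"
proof -
  have "i $ a = int N"
  proof (rule ccontr)
    assume *: "i $ a \<noteq> int N"
    have "1 \<le> (i + axis a 1) $ b \<and> (i + axis a 1) $ b \<le> int N" for b
      using assms(2) * by (cases "b = a") (auto simp: grid_faces_def axis_def)
    then have "i + axis a 1 \<in> grid_points N"
      by (simp add: grid_points_def)
    then have "i \<in> (\<lambda>i. i - axis a 1) ` grid_points N"
      by (rule rev_image_eqI) simp
    then show False
      using assms(2) by blast
  qed
  then show ?thesis
    using assms(1) by (simp add: disc_grad_boundary_face)
qed

text \<open>The added boundary terms are zero, whatever the ghost value of \<open>g\<close>. Writing
  \<open>neumann_ext N g\<close> lets this sum and the shifted one below, taken over the same faces,
  combine into the gradient of \<open>g\<close>.\<close>

lemma sum_disc_grad_grid_points: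
  assumes "N \<ge> 1"
  shows "(\<Sum>i\<in>grid_points N. disc_grad N f a i \<bullet> g i)
    = (\<Sum>i\<in>grid_faces N a. disc_grad N f a i \<bullet> neumann_ext N g i)"
proof -
  have "(\<Sum>i\<in>grid_points N. disc_grad N f a i \<bullet> g i)
      = (\<Sum>i\<in>grid_points N. disc_grad N f a i \<bullet> neumann_ext N g i)"
    by (simp add: neumann_ext_grid_points)
  also have "\<dots> = (\<Sum>i\<in>grid_faces N a. disc_grad N f a i \<bullet> neumann_ext N g i)"
    by (intro sum.mono_neutral_left ballI finite_grid_faces grid_points_subset_grid_faces)
      (simp add: disc_grad_eq_0_off_grid_points[OF assms])
  finally show ?thesis .
qed

lemma sum_disc_grad_shifted_grid_points:
  assumes "N \<ge> 1"
  shows "(\<Sum>i\<in>grid_points N. disc_grad N f a (i - axis a 1) \<bullet> g i)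
    = (\<Sum>i\<in>grid_faces N a. disc_grad N f a i \<bullet> neumann_ext N g (i + axis a 1))"
proof -
  let ?s = "\<lambda>i :: int ^ 'a. i - axis a 1"
  let ?F = "\<lambda>i. disc_grad N f a i \<bullet> neumann_ext N g (i + axis a 1)"
  have "(\<Sum>i\<in>grid_points N. disc_grad N f a (i - axis a 1) \<bullet> g i) = (\<Sum>i\<in>grid_points N. ?F (?s i))"
    by (simp add: neumann_ext_grid_points)
  also have "\<dots> = (\<Sum>i\<in>?s ` grid_points N. ?F i)"
    by (subst sum.reindex) (auto simp: inj_on_def)
  also have "\<dots> = (\<Sum>i\<in>grid_faces N a. ?F i)"
    by (intro sum.mono_neutral_left ballI finite_grid_faces grid_points_shift_subset_grid_faces)
      (simp add: disc_grad_eq_0_off_shifted_grid_points[OF assms])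
  finally show ?thesis .
qed

text \<open>Summation by parts; no boundary terms arise, since the gradient of \<open>f\<close>
  vanishes on boundary faces.\<close>

lemma grid_inner_disc_laplace:
  assumes "N \<ge> 1"
  shows "grid_inner N (disc_laplace N f) g = - face_inner N (disc_grad N f) (disc_grad N g)"
proof -
  let ?h = "mesh_size N"
  have "(\<Sum>i\<in>grid_points N. disc_laplace N f i \<bullet> g i)
      = (\<Sum>i\<in>grid_points N. \<Sum>a\<in>UNIV.
          (disc_grad N f a i \<bullet> g i - disc_grad N f a (i - axis a 1) \<bullet> g i) / ?h)"
    by (simp add: disc_laplace_eq_disc_grad inner_sum_left inner_diff_left
        divide_inverse mult.commute)
  also have "\<dots> = (\<Sum>a\<in>UNIV. ((\<Sum>i\<in>grid_points N. disc_grad N f a i \<bullet> g i)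
      - (\<Sum>i\<in>grid_points N. disc_grad N f a (i - axis a 1) \<bullet> g i)) / ?h)"
    by (subst sum.swap) (simp add: sum_subtractf flip: sum_divide_distrib)
  \<comment> \<open>With both sums over the same faces, the factor multiplying the gradient of
    \<open>f\<close> is the value of \<open>g\<close> at the lower cell minus that at the upper
    cell, over the mesh size; hence the minus sign.\<close>
  also have "\<dots> = (\<Sum>a\<in>UNIV. - (\<Sum>i\<in>grid_faces N a. disc_grad N f a i \<bullet> disc_grad N g a i))"
    unfolding sum_disc_grad_grid_points[OF assms] sum_disc_grad_shifted_grid_points[OF assms]
  proof (intro sum.cong refl)
    fix a :: 'a
    show "((\<Sum>i\<in>grid_faces N a. disc_grad N f a i \<bullet> neumann_ext N g i)
        - (\<Sum>i\<in>grid_faces N a. disc_grad N f a i \<bullet> neumann_ext N g (i + axis a 1))) / ?h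
      = - (\<Sum>i\<in>grid_faces N a. disc_grad N f a i \<bullet> disc_grad N g a i)"
      unfolding sum_subtractf[symmetric] sum_negf[symmetric] sum_divide_distrib
      by (intro sum.cong refl)
        (simp add: disc_grad_def[of N g] inner_diff_right divide_inverse algebra_simps)
  qed
  finally show ?thesis
    by (simp add: grid_inner_def face_inner_def sum_negf)
qed

lemma neumann_ext_add: "neumann_ext N (\<lambda>i. f i + g i) i = neumann_ext N f i + neumann_ext N g i"
  and neumann_ext_diff: "neumann_ext N (\<lambda>i. f i - g i) i = neumann_ext N f i - neumann_ext N g i"
  and neumann_ext_scaleR: "neumann_ext N (\<lambda>i. c *\<^sub>R f i) i = c *\<^sub>R neumann_ext N f i"
  by (simp_all add: neumann_ext_def)

lemma disc_grad_add: "disc_grad N (\<lambda>i. f i + g i) a i = disc_grad N f a i + disc_grad N g a i"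
  and disc_grad_diff: "disc_grad N (\<lambda>i. f i - g i) a i = disc_grad N f a i - disc_grad N g a i"
  and disc_grad_scaleR: "disc_grad N (\<lambda>i. c *\<^sub>R f i) a i = c *\<^sub>R disc_grad N f a i"
  by (simp_all add: disc_grad_def neumann_ext_add neumann_ext_diff neumann_ext_scaleR algebra_simps)

text \<open>The discrete gradient is linear, so this is (x + y) . (x - y) = x . x - y . y on each
  face.\<close>

lemma face_inner_disc_grad_average_difference:
  "face_inner N (disc_grad N (\<lambda>i. (u i + v i) /\<^sub>R b)) (disc_grad N (\<lambda>i. (u i - v i) /\<^sub>R c))
    = (face_inner N (disc_grad N u) (disc_grad N u)
        - face_inner N (disc_grad N v) (disc_grad N v)) / (b * c)"
proof -
  have *: "disc_grad N (\<lambda>i. (u i + v i) /\<^sub>R b) a i \<bullet> disc_grad N (\<lambda>i. (u i - v i) /\<^sub>R c) a i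
      = (disc_grad N u a i \<bullet> disc_grad N u a i - disc_grad N v a i \<bullet> disc_grad N v a i) / (b * c)"
    for a i
    by (simp add: disc_grad_add disc_grad_diff disc_grad_scaleR inner_add_left inner_diff_right
        inner_commute divide_inverse algebra_simps)
  show ?thesis
    by (simp add: face_inner_def * sum_subtractf flip: sum_divide_distrib)
      (simp add: right_diff_distrib)
qed

lemma mesh_size_nonneg: "mesh_size N \<ge> 0"
  by (simp add: mesh_size_def)

lemma grid_inner_self_nonneg: "grid_inner N f f \<ge> 0"
  by (simp add: grid_inner_def mesh_size_nonneg sum_nonneg)

lemma face_inner_self_nonneg: "face_inner N F F \<ge> 0"
  by (simp add: face_inner_def mesh_size_nonneg sum_nonneg)

lemma grid_norm_squared: "(grid_norm N f)\<^sup>2 = grid_inner N f f"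
  by (simp add: grid_norm_def grid_inner_self_nonneg)

lemma face_norm_squared: "(face_norm N F)\<^sup>2 = face_inner N F F"
  by (simp add: face_norm_def face_inner_self_nonneg)

lemma inner_eq_0_of_eq_cross3: "d = cross3 m p \<Longrightarrow> p \<bullet> d = 0"
  by (simp add: dot_cross_self)

text \<open>All cross products share the left factor \<open>m\<close> and merge by bilinearity into
  a single one, to whose right factor \<open>d\<close> is then orthogonal.\<close>

lemma scheme_orthogonality:
  assumes "d - \<alpha> *\<^sub>R cross3 m (d + \<tau> *\<^sub>R w) = - cross3 m l"
  shows "\<alpha> * (d \<bullet> d) + \<alpha> * \<tau> * (w \<bullet> d) = l \<bullet> d"
proof -
  have "d = cross3 m (\<alpha> *\<^sub>R (d + \<tau> *\<^sub>R w) - l)"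
    using assms by (simp add: cross_mult_right cross_add_right Cross3.right_diff_distrib algebra_simps)
  from inner_eq_0_of_eq_cross3[OF this] show ?thesis
    by (simp add: inner_add_left inner_diff_left algebra_simps)
qed

text \<open>The second difference is (u - v) - (v - w), while u - w is (u - v) + (v - w), so the
  product is again a difference of squares.\<close>

lemma second_difference_inner_difference:
  fixes u v w :: "'a::real_inner"
  assumes "k \<noteq> 0"
  shows "((u - 2 *\<^sub>R v + w) /\<^sub>R k\<^sup>2) \<bullet> ((u - w) /\<^sub>R (2 * k))
    = (((u - v) /\<^sub>R k) \<bullet> ((u - v) /\<^sub>R k) - ((v - w) /\<^sub>R k) \<bullet> ((v - w) /\<^sub>R k)) / (2 * k)"
proof -
  have "(u - 2 *\<^sub>R v + w) \<bullet> (u - w) = (u - v) \<bullet> (u - v) - (v - w) \<bullet> (v - w)"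
    by (simp add: inner_commute algebra_simps)
  then show ?thesis
    using assms
    by (simp only: inner_scaleR_left inner_scaleR_right) (simp add: field_simps power2_eq_square)
qed

theorem theorem2p1:
  fixes \<alpha> \<tau> k :: real and N :: nat
    and m_prev m_cur m_next :: "('d::finite) grid_fun"
  assumes "CARD('d) \<in> {1, 2, 3}"
    and "N \<ge> 1"
    and "\<alpha> > 0" and "\<tau> > 0" and "k > 0"
    and "\<forall>i\<in>grid_points N. m_prev i \<in> sphere 0 1"
    and "\<forall>i\<in>grid_points N. m_cur i \<in> sphere 0 1"
    and "\<forall>i\<in>grid_points N. m_next i \<in> sphere 0 1"
    and "\<forall>i\<in>grid_points N.
           (m_next i - m_prev i) /\<^sub>R (2 * k)
           - \<alpha> *\<^sub>R cross3 ((m_next i + m_prev i) /\<^sub>R 2)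
               ((m_next i - m_prev i) /\<^sub>R (2 * k)
                + \<tau> *\<^sub>R ((m_next i - 2 *\<^sub>R m_cur i + m_prev i) /\<^sub>R k\<^sup>2))
           = - cross3 ((m_next i + m_prev i) /\<^sub>R 2)
                 (disc_laplace N (\<lambda>j. (m_next j + m_prev j) /\<^sub>R 2) i)"
  shows "modified_energy N k \<alpha> \<tau> m_next m_cur \<le> modified_energy N k \<alpha> \<tau> m_cur m_prev"
proof -
  define D where "D = (\<lambda>i. (m_next i - m_prev i) /\<^sub>R (2 * k))"
  define M where "M = (\<lambda>i. (m_next i + m_prev i) /\<^sub>R 2)"
  \<comment> \<open>\<open>A\<close> and \<open>B\<close> are the one-step difference quotients in
    the new and the old energy; \<open>D\<close> is their mean.\<close>
  define A where "A = (\<lambda>i. (m_next i - m_cur i) /\<^sub>R k)"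
  define B where "B = (\<lambda>i. (m_cur i - m_prev i) /\<^sub>R k)"
  define G where "G = (\<lambda>u. face_inner N (disc_grad N u) (disc_grad N (u :: 'd grid_fun)))"
  have pointwise: "\<alpha> * (D i \<bullet> D i) + \<alpha> * \<tau> * ((A i \<bullet> A i - B i \<bullet> B i) / (2 * k))
      = disc_laplace N M i \<bullet> D i" if "i \<in> grid_points N" for i
    using scheme_orthogonality[OF bspec[OF assms(9) that]]
    unfolding D_def M_def A_def B_def
      second_difference_inner_difference[OF less_imp_neq[OF \<open>k > 0\<close>, symmetric]] .
  have "grid_inner N (disc_laplace N M) D
      = mesh_size N ^ CARD('d) * (\<Sum>i\<in>grid_points N.
          \<alpha> * (D i \<bullet> D i) + \<alpha> * \<tau> * ((A i \<bullet> A i - B i \<bullet> B i) / (2 * k)))"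
    unfolding grid_inner_def by (simp only: pointwise cong: sum.cong)
  also have "\<dots> = \<alpha> * grid_inner N D D
      + \<alpha> * \<tau> * ((grid_inner N A A - grid_inner N B B) / (2 * k))"
    unfolding grid_inner_def
    by (simp add: sum.distrib sum_subtractf flip: sum_distrib_left sum_divide_distrib)
      (simp add: field_simps)
  \<comment> \<open>In the denominator, one factor 2 comes from the average \<open>M\<close> and
    \<open>2 * k\<close> from the centred quotient \<open>D\<close>.\<close>
  finally have balance: "\<alpha> * grid_inner N D D
      + \<alpha> * \<tau> * ((grid_inner N A A - grid_inner N B B) / (2 * k))
      = - ((G m_next - G m_prev) / (2 * (2 * k)))"
    unfolding grid_inner_disc_laplace[OF \<open>N \<ge> 1\<close>] D_def M_def G_def
      face_inner_disc_grad_average_difference by simp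
  \<comment> \<open>The left side is the full energy increment: \<open>G m_cur\<close> enters both
    energies with weight 1/4 and cancels. By \<open>balance\<close>, the increment equals -k
    \<alpha> times the squared norm of \<open>D\<close>.\<close>
  have "\<alpha> * \<tau> / 2 * (grid_inner N A A - grid_inner N B B) + 1 / 4 * (G m_next - G m_prev)
      = k * (\<alpha> * \<tau> * ((grid_inner N A A - grid_inner N B B) / (2 * k))
          + (G m_next - G m_prev) / (2 * (2 * k)))"
    using \<open>k > 0\<close> by (simp add: field_simps)
  also have "\<dots> = k * - (\<alpha> * grid_inner N D D)"
    by (rule arg_cong[where f = "(*) k"]) (use balance in linarith)
  also have "\<dots> \<le> 0"
    using \<open>k > 0\<close> \<open>\<alpha> > 0\<close> by (simp add: grid_inner_self_nonneg)
  finally show ?thesis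
    unfolding modified_energy_def grid_norm_squared face_norm_squared
      A_def[symmetric] B_def[symmetric] G_def
    by (simp add: algebra_simps)
qed

end
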